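(* Let $n,N\ge1$ be integers. For all $\mathbf m,\mathbf m'\in\breve D_N^n$, $$\sum_{\mathbf s\in F_N^n}c_{\mathbf s}\cos^+_{\mathbf m}(\mathbf s)\cos^+_{\mathbf m'}(\mathbf s)=|S_n|\sum_{\mathbf s\in\breve F_N^n}|S_{\mathbf s}|^{-1}c_{\mathbf s}\cos^+_{\mathbf m}(\mathbf s)\cos^+_{\mathbf m'}(\mathbf s)=N^n\,r_{\mathbf m}\,|S_{\mathbf m}|\,\delta_{\mathbf m\mathbf m'} .$$
   Context: $F_N=\{0,\frac1N,\frac2N,\dots,\frac{N-1}N,1\}$ and $F_N^n$ is its $n$-fold Cartesian power; $\breve F_N^n$ is the set of $\mathbf s=(s_1,\dots,s_n)\in F_N^n$ with $s_1\ge s_2\ge\cdots\ge s_n$; $\breve D_N^n$ is the set of integer $n$-tuples $\mathbf m$ with $N\ge m_1\ge m_2\ge\cdots\ge m_n\ge0$. $S_n$ is the symmetric group, $|S_n|=n!$; for an $n$-tuple $\mathbf t$, $S_{\mathbf t}\subset S_n$ is the subgroup of permutations leaving $\mathbf t$ invariant and $|S_{\mathbf t}|$ its order. $\cos^+_{\mathbf m}(\mathbf s)=|S_n|^{-1/2}\sum_{w\in S_n}\prod_{j=1}^n\cos(\pi m_{w(j)}s_j)$. $c_{\mathbf s}=c_{s_1}\cdots c_{s_n}$ with $c_s=\frac12$ for $s\in\{0,1\}$ and $c_s=1$ otherwise; $r_{\mathbf m}=r_{m_1}\cdots r_{m_n}$ with $r_m=1$ for $m\in\{0,N\}$ and $r_m=\frac12$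 otherwise. *)

theory Defs
  imports Complex_Main "HOL-Library.FuncSet" "HOL-Combinatorics.Permutations"
begin

text \<open>
  An n-tuple with entries in \<open>A\<close> is an element of \<open>{1..n} \<rightarrow>\<^sub>E A\<close>: a function that is
  \<open>undefined\<close> outside \<open>{1..n}\<close>, so that distinct functions represent distinct tuples.
  A permutation \<open>w\<close> sends the tuple \<open>t\<close> to the tuple with \<open>j\<close>-th entry \<open>t (w j)\<close>.
\<close>

definition grid :: "nat \<Rightarrow> real set" where
  "grid N = {real k / real N | k. k \<le> N}"

definition grid_tuples :: "nat \<Rightarrow> nat \<Rightarrow> (nat \<Rightarrow> real) set" where
  "grid_tuples n N = {1..n} \<rightarrow>\<^sub>E grid N"

definition ordered_grid_tuples :: "nat \<Rightarrow> nat \<Rightarrow> (nat \<Rightarrow> real) set" where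
  "ordered_grid_tuples n N = {s \<in> grid_tuples n N. antimono_on {1..n} s}"

definition ordered_int_tuples :: "nat \<Rightarrow> nat \<Rightarrow> (nat \<Rightarrow> int) set" where
  "ordered_int_tuples n N = {m \<in> {1..n} \<rightarrow>\<^sub>E {0..int N}. antimono_on {1..n} m}"

definition perms :: "nat \<Rightarrow> (nat \<Rightarrow> nat) set" where
  "perms n = {w. w permutes {1..n}}"

definition tuple_stabilizer :: "nat \<Rightarrow> (nat \<Rightarrow> 'a) \<Rightarrow> (nat \<Rightarrow> nat) set" where
  "tuple_stabilizer n t = {w \<in> perms n. \<forall>j\<in>{1..n}. t (w j) = t j}"

definition cos_sym :: "nat \<Rightarrow> (nat \<Rightarrow> int) \<Rightarrow> (nat \<Rightarrow> real) \<Rightarrow> real" where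
  "cos_sym n m s =
     real (card (perms n)) powr (- 1 / 2) *
     (\<Sum>w\<in>perms n. \<Prod>j=1..n. cos (pi * of_int (m (w j)) * s j))"

definition c_weight :: "real \<Rightarrow> real" where
  "c_weight s = (if s \<in> {0, 1} then 1 / 2 else 1)"

definition c_tuple :: "nat \<Rightarrow> (nat \<Rightarrow> real) \<Rightarrow> real" where
  "c_tuple n s = (\<Prod>j=1..n. c_weight (s j))"

definition r_weight :: "nat \<Rightarrow> int \<Rightarrow> real" where
  "r_weight N m = (if m \<in> {0, int N} then 1 else 1 / 2)"

definition r_tuple :: "nat \<Rightarrow> nat \<Rightarrow> (nat \<Rightarrow> int) \<Rightarrow> real" where
  "r_tuple n N m = (\<Prod>j=1..n. r_weight N (m j))"

end

theory Submission
  imports Defs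
begin

text \<open>
  A symmetric function summed over all tuples can be summed over decreasing tuples instead, each
  decreasing tuple \<open>s\<close> standing for its orbit of size \<open>n! / |S\<^sub>s|\<close>. Expanding both cosine functions
  over permutations and interchanging the sum over the grid with the product over coordinates
  reduces the inner product to the one-dimensional orthogonality relation, so that only pairs \<open>(w, w')\<close> with
  \<open>m \<circ> w = m' \<circ> w'\<close> survive. Decreasing tuples with this property are equal, and there are
  \<open>n! |S\<^sub>m|\<close> such pairs when \<open>m = m'\<close>.
\<close>

section \<open>One-dimensional orthogonality\<close>

text \<open>Multiplying by \<open>sin (x / 2)\<close> makes the sum telescope in
  \<open>sin (real k * x)\<close>. Keeping this factor on the left avoids dividing by zero when
  \<open>x\<close> is a multiple of 2 pi.\<close>

lemma sin_half_times_trapezoidal_cos_sum: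
  fixes x :: real
  shows "sin (x / 2) * (\<Sum>k<K. cos (real k * x) + cos (real (Suc k) * x))
           = cos (x / 2) * sin (real K * x)"
proof (induction K)
  case 0
  show ?case by simp
next
  case (Suc K)
  \<comment> \<open>\<open>z\<close> is the midpoint of two consecutive angles, so that the addition
    formulas for \<open>z - x / 2\<close> and \<open>z + x / 2\<close> mirror each other.\<close>
  define z where "z = real K * x + x / 2"
  have z: "real K * x = z - x / 2" "real (Suc K) * x = z + x / 2"
    by (simp_all add: z_def field_simps)
  have "sin (x / 2) * (cos (real K * x) + cos (real (Suc K) * x))
      = cos (x / 2) * (sin (real (Suc K) * x) - sin (real K * x))"
    unfolding z by (simp add: cos_add cos_diff sin_add sin_diff algebra_simps)
  with Suc.IH show ?case
    by (simp add: algebra_simps)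
qed

lemma grid_eq_image: "grid N = (\<lambda>k. real k / real N) ` {..N}"
  by (auto simp: grid_def)

lemma finite_grid: "finite (grid N)"
  by (simp add: grid_eq_image)

text \<open>The weight 1/2 at the end points is that of the trapezoidal rule: each interior grid
  point belongs to two neighbouring pairs, each end point to one.\<close>

lemma sum_grid_trapezoidal:
  assumes "N \<ge> 1"
  shows "(\<Sum>s\<in>grid N. c_weight s * f s)
           = (\<Sum>k<N. f (real k / real N) + f (real (Suc k) / real N)) / 2"
proof -
  let ?g = "\<lambda>k. f (real k / real N)"
  have "(\<Sum>s\<in>grid N. c_weight s * f s) = (\<Sum>k\<le>N. c_weight (real k / real N) * ?g k)"
    unfolding grid_eq_image using assms by (subst sum.reindex) (auto simp: inj_on_def)
  \<comment> \<open>The two half-value corrections fall on different indices because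
    \<open>N\<close> is positive.\<close>
  also have "\<dots> = (\<Sum>k\<le>N. ?g k - (if k = 0 then ?g k / 2 else 0) - (if k = N then ?g k / 2 else 0))"
    using assms by (intro sum.cong) (auto simp: c_weight_def)
  also have "\<dots> = (\<Sum>k\<le>N. ?g k) - ?g 0 / 2 - ?g N / 2"
    by (simp add: sum_subtractf)
  also have "\<dots> = (\<Sum>k<N. ?g k + ?g (Suc k)) / 2"
  proof -
    have "(\<Sum>k\<le>N. ?g k) = (\<Sum>k<N. ?g k) + ?g N"
      by (simp add: lessThan_Suc_atMost[symmetric])
    moreover have "(\<Sum>k\<le>N. ?g k) = ?g 0 + (\<Sum>k<N. ?g (Suc k))"
      by (simp only: lessThan_Suc_atMost[symmetric] sum.lessThan_Suc_shift)
    ultimately show ?thesis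
      by (simp only: sum.distrib) argo
  qed
  finally show ?thesis .
qed

text \<open>The range of \<open>a\<close> covers sums and differences of two frequencies in
  \<open>{0..int N}\<close>. In the exceptional cases every cosine is 1. Otherwise the step angle
  \<open>x\<close> lies strictly between 0 and 2 pi, so \<open>sin (x / 2)\<close> is nonzero while
  \<open>sin (real N * x)\<close> vanishes, and the telescoped identity forces the sum to be
  0.\<close>

lemma sum_grid_cos:
  assumes N: "N \<ge> 1" and a: "\<bar>a\<bar> \<le> 2 * int N"
  shows "(\<Sum>s\<in>grid N. c_weight s * cos (pi * of_int a * s))
           = (if a = 0 \<or> \<bar>a\<bar> = 2 * int N then real N else 0)"
proof -
  define x where "x = pi * real_of_int \<bar>a\<bar> / real N"
  \<comment> \<open>Only the sign of the angle can be lost by passing to the absolute value of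
    \<open>a\<close>, and cosine is even.\<close>
  have "pi * of_int a * (real k / real N) = real k * x
      \<or> pi * of_int a * (real k / real N) = - (real k * x)" for k
    by (simp add: x_def abs_if)
  then have x: "cos (pi * of_int a * (real k / real N)) = cos (real k * x)" for k
    by (metis cos_minus)
  have T: "(\<Sum>s\<in>grid N. c_weight s * cos (pi * of_int a * s))
      = (\<Sum>k<N. cos (real k * x) + cos (real (Suc k) * x)) / 2"
    by (simp only: sum_grid_trapezoidal[OF N] x)
  show ?thesis
  proof (cases "a = 0 \<or> \<bar>a\<bar> = 2 * int N")
    case True
    then have "a = 0 \<or> real_of_int \<bar>a\<bar> = 2 * real N" by linarith
    then have "x = 0 \<or> x = 2 * pi"
      using N by (auto simp: x_def simp del: of_int_abs)
    then have "cos (real k * x) = 1" for k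
      by (auto simp: cos_one_2pi mult.assoc)
    then show ?thesis
      unfolding T using True by (simp del: of_nat_Suc)
  next
    case False
    with a have "0 < \<bar>a\<bar>" "\<bar>a\<bar> < 2 * int N" by auto
    then have "0 < real_of_int \<bar>a\<bar>" "real_of_int \<bar>a\<bar> < 2 * real N" by linarith+
    then have "0 < x / 2" "x / 2 < pi"
      using N by (simp_all add: x_def field_simps)
    then have "sin (x / 2) \<noteq> 0"
      using sin_gt_zero by fastforce
    moreover have "real N * x = pi * real_of_int \<bar>a\<bar>"
      using N by (simp add: x_def)
    then have "sin (real N * x) = 0"
      by (metis mult.commute sin_zero_iff_int2)
    ultimately show ?thesis
      unfolding T using sin_half_times_trapezoidal_cos_sum[of x N] False by simp
  qed
qed

text \<open>Product-to-sum yields the frequencies \<open>a - b\<close> and \<open>a + b\<close>. The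
  first contributes exactly when \<open>a = b\<close>, the second exactly when \<open>a = b\<close>
  is 0 or \<open>N\<close>; this extra contribution is why \<open>r_weight\<close> doubles
  there.\<close>

lemma sum_grid_cos_cos:
  assumes N: "N \<ge> 1" and a: "a \<in> {0..int N}" and b: "b \<in> {0..int N}"
  shows "(\<Sum>s\<in>grid N. c_weight s * (cos (pi * of_int a * s) * cos (pi * of_int b * s)))
           = (if a = b then real N * r_weight N a else 0)"
proof -
  have "c_weight s * (cos (pi * of_int a * s) * cos (pi * of_int b * s))
      = (c_weight s * cos (pi * of_int (a - b) * s)
          + c_weight s * cos (pi * of_int (a + b) * s)) / 2" for s
    by (simp add: cos_times_cos algebra_simps add_divide_distrib)
  then have "(\<Sum>s\<in>grid N. c_weight s * (cos (pi * of_int a * s) * cos (pi * of_int b * s)))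
      = ((\<Sum>s\<in>grid N. c_weight s * cos (pi * of_int (a - b) * s))
          + (\<Sum>s\<in>grid N. c_weight s * cos (pi * of_int (a + b) * s))) / 2"
    by (simp only: sum.distrib sum_divide_distrib[symmetric])
  also have "\<dots> = (if a = b then real N * r_weight N a else 0)"
    using a b N by (subst (1 2) sum_grid_cos) (auto simp: r_weight_def)
  finally show ?thesis .
qed

section \<open>Orbits of tuples\<close>

lemma finite_perms: "finite (perms n)"
  by (simp add: perms_def finite_permutations)

lemma card_perms_pos: "card (perms n) > 0"
  unfolding perms_def by (subst card_permutations[OF refl]) simp_all

lemma perms_compose: "v \<in> perms n \<Longrightarrow> w \<in> perms n \<Longrightarrow> v \<circ> w \<in> perms n"
  by (simp add: perms_def permutes_compose)

lemma perms_inv: "w \<in> perms n \<Longrightarrow> inv w \<in> perms n"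
  by (simp add: perms_def permutes_inv)

lemma perms_bij: "w \<in> perms n \<Longrightarrow> bij w"
  by (simp add: perms_def permutes_bij)

lemma perms_in_iff: "w \<in> perms n \<Longrightarrow> w j \<in> {1..n} \<longleftrightarrow> j \<in> {1..n}"
  unfolding perms_def by (simp only: mem_Collect_eq permutes_in_image)

lemma perms_bij_betw: "w \<in> perms n \<Longrightarrow> bij_betw w {1..n} {1..n}"
  by (simp add: perms_def permutes_imp_bij)

lemma PiE_comp_perms:
  assumes "s \<in> {1..n} \<rightarrow>\<^sub>E A" "w \<in> perms n"
  shows "s \<circ> w \<in> {1..n} \<rightarrow>\<^sub>E A"
proof (rule PiE_I)
  show "(s \<circ> w) j \<in> A" if "j \<in> {1..n}" for j
    using PiE_mem[OF assms(1), of "w j"] perms_in_iff[OF assms(2)] that by simp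
  show "(s \<circ> w) j = undefined" if "j \<notin> {1..n}" for j
    unfolding comp_apply using perms_in_iff[OF assms(2)] that by (intro PiE_arb[OF assms(1)]) blast
qed

lemma tuple_stabilizer_altdef:
  assumes "s \<in> {1..n} \<rightarrow>\<^sub>E A"
  shows "tuple_stabilizer n s = {w \<in> perms n. s \<circ> w = s}"
proof -
  have "s \<circ> w = s \<longleftrightarrow> (\<forall>j\<in>{1..n}. s (w j) = s j)" if "w \<in> perms n" for w
    by (metis PiE_comp_perms PiE_ext assms comp_apply that)
  then show ?thesis
    by (auto simp: tuple_stabilizer_def)
qed

text \<open>The permutations counted on the left form the coset of the stabilizer obtained by
  composing with \<open>v\<close> on the right.\<close>

lemma card_same_image_eq_card_stabilizer:
  assumes s: "s \<in> {1..n} \<rightarrow>\<^sub>E A" and v: "v \<in> perms n"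
  shows "card {w \<in> perms n. s \<circ> w = s \<circ> v} = card (tuple_stabilizer n s)"
proof (rule bij_betw_same_card[symmetric])
  have [simp]: "v \<circ> inv v = id" "inv v \<circ> v = id"
    using perms_bij[OF v] by (auto simp: bij_def surj_iff inj_iff)
  have "(w \<circ> v) \<circ> inv v = w" "(w \<circ> inv v) \<circ> v = w" for w :: "nat \<Rightarrow> nat"
    by (simp_all add: comp_assoc)
  moreover have "s \<circ> (w \<circ> inv v) = s" if "s \<circ> w = s \<circ> v" for w
    using that by (metis \<open>v \<circ> inv v = id\<close> comp_assoc comp_id)
  ultimately show "bij_betw (\<lambda>w. w \<circ> v) (tuple_stabilizer n s) {w \<in> perms n. s \<circ> w = s \<circ> v}"
    unfolding tuple_stabilizer_altdef[OF s]
    by (intro bij_betw_byWitness[where f' = "\<lambda>w. w \<circ> inv v"])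
       (auto intro: perms_compose perms_inv v simp flip: comp_assoc)
qed

text \<open>If \<open>g j < f j\<close>, then at least \<open>j\<close> entries of \<open>f\<close> but fewer than \<open>j\<close> entries of \<open>g\<close> are
  \<open>\<ge> f j\<close>.\<close>

lemma antimono_rearrangement_le:
  fixes f g :: "nat \<Rightarrow> 'a::linorder"
  assumes f: "antimono_on {1..n} f" and g: "antimono_on {1..n} g"
    and w: "bij_betw w {1..n} {1..n}" and eq: "\<And>i. i \<in> {1..n} \<Longrightarrow> f (w i) = g i"
    and j: "j \<in> {1..n}"
  shows "f j \<le> g j"
proof (rule ccontr)
  assume "\<not> f j \<le> g j"
  then have less: "g j < f j" by simp
  \<comment> \<open>Positivity matters for the truncated subtraction: at \<open>j = 0\<close> the
    final bounds \<open>j\<close> and \<open>j - 1\<close> would not conflict.\<close>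
  have "1 \<le> j" using j by simp
  have "w ` {i \<in> {1..n}. f j \<le> g i} = {i \<in> w ` {1..n}. f j \<le> f i}"
    using eq by auto
  then have "w ` {i \<in> {1..n}. f j \<le> g i} = {i \<in> {1..n}. f j \<le> f i}"
    by (simp only: bij_betw_imp_surj_on[OF w])
  moreover have "inj_on w {i \<in> {1..n}. f j \<le> g i}"
    by (rule inj_on_subset[OF bij_betw_imp_inj_on[OF w]]) blast
  ultimately have card: "card {i \<in> {1..n}. f j \<le> f i} = card {i \<in> {1..n}. f j \<le> g i}"
    by (metis card_image)
  have "{1..j} \<subseteq> {i \<in> {1..n}. f j \<le> f i}"
    using f j by (auto simp: monotone_on_def)
  then have "j \<le> card {i \<in> {1..n}. f j \<le> f i}"
    using card_mono[of "{i \<in> {1..n}. f j \<le> f i}" "{1..j}"] by simp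
  moreover have "{i \<in> {1..n}. f j \<le> g i} \<subseteq> {1..<j}"
  proof
    fix i assume i: "i \<in> {i \<in> {1..n}. f j \<le> g i}"
    have "\<not> j \<le> i"
    proof
      assume "j \<le> i"
      with g i j have "g i \<le> g j" by (auto simp: monotone_on_def)
      with i less show False by auto
    qed
    with i show "i \<in> {1..<j}" by auto
  qed
  then have "card {i \<in> {1..n}. f j \<le> g i} \<le> j - 1"
    using card_mono[of "{1..<j}"] by simp
  ultimately show False
    using card \<open>1 \<le> j\<close> by linarith
qed

text \<open>Each tuple is a rearrangement of the other, through \<open>v \<circ> inv w\<close> and
  its inverse, so the one-sided comparison applies in both directions. Outside the index range both
  are \<open>undefined\<close>.\<close>

lemma antimono_rearrangement_unique:
  fixes s t :: "nat \<Rightarrow> 'a::linorder"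
  assumes s: "s \<in> {1..n} \<rightarrow>\<^sub>E A" "antimono_on {1..n} s"
    and t: "t \<in> {1..n} \<rightarrow>\<^sub>E B" "antimono_on {1..n} t"
    and w: "v \<in> perms n" "w \<in> perms n" "s \<circ> v = t \<circ> w"
  shows "s = t"
proof (rule ext)
  fix j
  have "surj v" "surj w"
    using w perms_bij by (auto simp: bij_def)
  then have *: "s \<circ> (v \<circ> inv w) = t" "t \<circ> (w \<circ> inv v) = s"
    using w(3) by (metis comp_assoc comp_id surj_iff)+
  have vw: "v \<circ> inv w \<in> perms n" "w \<circ> inv v \<in> perms n"
    using w by (auto intro: perms_compose perms_inv)
  show "s j = t j"
  proof (cases "j \<in> {1..n}")
    case True
    have "s j \<le> t j"
      using antimono_rearrangement_le[OF s(2) t(2) perms_bij_betw[OF vw(1)] _ True] *(1)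
      by (metis comp_apply)
    moreover have "t j \<le> s j"
      using antimono_rearrangement_le[OF t(2) s(2) perms_bij_betw[OF vw(2)] _ True] *(2)
      by (metis comp_apply)
    ultimately show ?thesis by simp
  next
    case False
    then show ?thesis
      using s(1) t(1) by (metis PiE_arb)
  qed
qed

text \<open>The permutation \<open>w\<close> sends an index to its rank, ties being broken by position.\<close>

lemma antimono_rearrangement_exists:
  fixes t :: "nat \<Rightarrow> 'a::linorder"
  shows "\<exists>w\<in>perms n. antimono_on {1..n} (t \<circ> w)"
proof -
  \<comment> \<open>\<open>R j\<close> collects the indices that come no later than \<open>j\<close>
    in the sorted order. It contains \<open>j\<close> itself, so ranks start at 1.\<close>
  define R where "R j = {i \<in> {1..n}. t j < t i \<or> (t i = t j \<and> i \<le> j)}" for j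
  define w where "w j = (if j \<in> {1..n} then card (R j) else j)" for j
  have fin: "finite (R j)" for j
    by (simp add: R_def)
  have less: "card (R a) < card (R b)"
    if "a \<in> {1..n}" "b \<in> {1..n}" "t b < t a \<or> (t a = t b \<and> a < b)" for a b
  proof (rule psubset_card_mono[OF fin])
    have "b \<in> R b" "b \<notin> R a" "R a \<subseteq> R b"
      using that by (auto simp: R_def)
    then show "R a \<subset> R b" by blast
  qed
  have inj: "inj_on w {1..n}"
  proof (rule inj_onI)
    fix a b assume ab: "a \<in> {1..n}" "b \<in> {1..n}" "w a = w b"
    then have "card (R a) = card (R b)" by (simp add: w_def)
    then show "a = b"
      using less[OF ab(1,2)] less[OF ab(2,1)] by (metis less_irrefl linorder_less_linear)
  qed
  have "w ` {1..n} \<subseteq> {1..n}"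
  proof
    fix x assume "x \<in> w ` {1..n}"
    then obtain j where j: "j \<in> {1..n}" "x = card (R j)" by (auto simp: w_def)
    then have "j \<in> R j" "R j \<subseteq> {1..n}" by (auto simp: R_def)
    then have "0 < card (R j)" "card (R j) \<le> n"
      using card_mono[of "{1..n}" "R j"] fin by (auto simp: card_gt_0_iff)
    with j show "x \<in> {1..n}" by simp
  qed
  with inj have "bij_betw w {1..n} {1..n}"
    by (simp add: bij_betw_def endo_inj_surj)
  then have w: "w \<in> perms n"
    unfolding perms_def by (auto intro!: bij_imp_permutes simp: w_def)
  \<comment> \<open>The witness is the inverse of \<open>w\<close>: position \<open>c\<close> of the
    sorted tuple must hold the entry whose rank is \<open>c\<close>.\<close>
  have "antimono_on {1..n} (t \<circ> inv w)"
  proof (rule monotone_onI)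
    fix a b assume ab: "a \<in> {1..n}" "b \<in> {1..n}" "a \<le> b"
    have w_inv: "w (inv w c) = c" for c
      using perms_bij[OF w] by (simp add: bij_def surj_f_inv_f)
    have in_range: "inv w a \<in> {1..n}" "inv w b \<in> {1..n}"
      using ab(1,2) perms_in_iff[OF perms_inv[OF w]] by blast+
    have rank: "card (R (inv w c)) = c" if "inv w c \<in> {1..n}" for c
      using w_inv[of c] that unfolding w_def[of "inv w c"] by simp
    show "(t \<circ> inv w) b \<le> (t \<circ> inv w) a"
    proof (rule ccontr)
      assume "\<not> ?thesis"
      then have "card (R (inv w b)) < card (R (inv w a))"
        using in_range by (intro less) auto
      with ab(3) show False
        unfolding rank[OF in_range(1)] rank[OF in_range(2)] by simp
    qed
  qed
  with perms_inv[OF w] show ?thesis by blast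
qed

text \<open>Pairs \<open>(s, w)\<close> with \<open>s\<close> decreasing are counted instead of
  orbits. A given tuple equals \<open>s \<circ> w\<close> for just one decreasing \<open>s\<close>,
  and then for as many \<open>w\<close> as the stabilizer of \<open>s\<close> has elements, so the
  inverse weights add up to 1.\<close>

lemma sum_tuples_eq_sum_antimono_tuples:
  fixes A :: "'a::linorder set" and g :: "(nat \<Rightarrow> 'a) \<Rightarrow> real"
  assumes A: "finite A"
    and sym: "\<And>s w. s \<in> {1..n} \<rightarrow>\<^sub>E A \<Longrightarrow> w \<in> perms n \<Longrightarrow> g (s \<circ> w) = g s"
  shows "(\<Sum>s\<in>{1..n} \<rightarrow>\<^sub>E A. g s)
           = real (card (perms n)) *
             (\<Sum>s\<in>{s \<in> {1..n} \<rightarrow>\<^sub>E A. antimono_on {1..n} s}.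
                inverse (real (card (tuple_stabilizer n s))) * g s)"
proof -
  let ?T = "{1..n} \<rightarrow>\<^sub>E A"
  let ?O = "{s \<in> ?T. antimono_on {1..n} s}"
  let ?c = "\<lambda>s. inverse (real (card (tuple_stabilizer n s)))"
  have finT: "finite ?T" using A by (simp add: finite_PiE)
  have finO: "finite ?O" using finT by simp
  have orbit: "(\<Sum>s\<in>?O. \<Sum>w\<in>perms n. if s \<circ> w = t then ?c s else 0) = 1" if t: "t \<in> ?T" for t
  proof -
    obtain v where v: "v \<in> perms n" "antimono_on {1..n} (t \<circ> v)"
      using antimono_rearrangement_exists by blast
    define s\<^sub>0 where "s\<^sub>0 = t \<circ> v"
    have s0: "s\<^sub>0 \<in> ?O"
      using v PiE_comp_perms[OF t v(1)] by (simp add: s\<^sub>0_def)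
    have t_eq: "t = s\<^sub>0 \<circ> inv v"
      using perms_bij[OF v(1)] by (simp add: s\<^sub>0_def comp_assoc bij_def surj_iff)
    \<comment> \<open>Uniqueness of the decreasing rearrangement leaves \<open>s\<^sub>0\<close> as
      the sole contributor.\<close>
    have only: "s \<circ> w \<noteq> t" if "s \<in> ?O - {s\<^sub>0}" "w \<in> perms n" for s w
      using that s0 antimono_rearrangement_unique[of s n A s\<^sub>0 A w "inv v"] perms_inv[OF v(1)]
      by (auto simp: t_eq)
    have "(\<Sum>s\<in>?O. \<Sum>w\<in>perms n. if s \<circ> w = t then ?c s else 0)
        = (\<Sum>w\<in>perms n. if s\<^sub>0 \<circ> w = t then ?c s\<^sub>0 else 0)"
      using only by (subst sum.remove[OF finO s0]) (simp add: sum.neutral)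
    also have "\<dots> = real (card {w \<in> perms n. s\<^sub>0 \<circ> w = s\<^sub>0 \<circ> inv v}) * ?c s\<^sub>0"
      by (simp add: t_eq sum.If_cases[OF finite_perms] Int_def)
    also have "\<dots> = real (card (tuple_stabilizer n s\<^sub>0)) * ?c s\<^sub>0"
      using card_same_image_eq_card_stabilizer[OF _ perms_inv[OF v(1)]] s0 by auto
    also have "\<dots> = 1"
    proof -
      have "id \<in> tuple_stabilizer n s\<^sub>0"
        by (simp add: tuple_stabilizer_def perms_def permutes_id)
      moreover have "finite (tuple_stabilizer n s\<^sub>0)"
        by (simp add: tuple_stabilizer_def finite_perms)
      ultimately have "card (tuple_stabilizer n s\<^sub>0) \<noteq> 0" by auto
      then show ?thesis by simp
    qed
    finally show ?thesis .
  qed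
  have "real (card (perms n)) * (\<Sum>s\<in>?O. ?c s * g s)
      = (\<Sum>s\<in>?O. \<Sum>w\<in>perms n. ?c s * g (s \<circ> w))"
    by (simp add: sum_distrib_left sym)
  \<comment> \<open>Summing over all \<open>t\<close> with an indicator of
    \<open>s \<circ> w = t\<close> lets the sum over \<open>t\<close> be moved outermost.\<close>
  also have "\<dots> = (\<Sum>s\<in>?O. \<Sum>w\<in>perms n. \<Sum>t\<in>?T. (if s \<circ> w = t then ?c s else 0) * g t)"
  proof (intro sum.cong refl)
    fix s w assume "s \<in> ?O" "w \<in> perms n"
    then have "s \<circ> w \<in> ?T" using PiE_comp_perms by blast
    then show "?c s * g (s \<circ> w) = (\<Sum>t\<in>?T. (if s \<circ> w = t then ?c s else 0) * g t)"
      using finT by (simp add: if_distrib[of "\<lambda>x. x * _"] cong: if_cong)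
  qed
  also have "\<dots> = (\<Sum>t\<in>?T. (\<Sum>s\<in>?O. \<Sum>w\<in>perms n. if s \<circ> w = t then ?c s else 0) * g t)"
    by (simp only: sum_distrib_right sum.swap[of _ "perms n" ?T] sum.swap[of _ ?O ?T])
  also have "\<dots> = (\<Sum>t\<in>?T. g t)"
    by (simp only: orbit cong: sum.cong) simp
  finally show ?thesis by simp
qed

section \<open>Symmetric cosine functions\<close>

lemma c_tuple_comp_perms:
  assumes "w \<in> perms n"
  shows "c_tuple n (s \<circ> w) = c_tuple n s"
  unfolding c_tuple_def
  using prod.reindex_bij_betw[OF perms_bij_betw[OF assms], of "\<lambda>j. c_weight (s j)"] by simp

lemma r_tuple_comp_perms:
  assumes "w \<in> perms n"
  shows "r_tuple n N (m \<circ> w) = r_tuple n N m"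
  unfolding r_tuple_def
  using prod.reindex_bij_betw[OF perms_bij_betw[OF assms], of "\<lambda>j. r_weight N (m j)"] by simp

text \<open>Replacing \<open>w\<close> by \<open>w \<circ> v\<close> only reorders the outer sum;
  each product is then reindexed along \<open>v\<close>.\<close>

lemma cos_sym_comp_perms:
  assumes v: "v \<in> perms n"
  shows "cos_sym n m (s \<circ> v) = cos_sym n m s"
proof -
  let ?f = "\<lambda>w. \<Prod>j=1..n. cos (pi * of_int (m (w j)) * s (v j))"
  have "(\<Sum>w\<in>perms n. ?f w) = (\<Sum>w\<in>perms n. ?f (w \<circ> v))"
    using v unfolding perms_def by (intro sum_permutations_compose_right) simp
  also have "\<dots> = (\<Sum>w\<in>perms n. \<Prod>j=1..n. cos (pi * of_int (m (w j)) * s j))"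
  proof (rule sum.cong[OF refl])
    fix w
    show "?f (w \<circ> v) = (\<Prod>j=1..n. cos (pi * of_int (m (w j)) * s j))"
      using prod.reindex_bij_betw[OF perms_bij_betw[OF v],
          of "\<lambda>j. cos (pi * of_int (m (w j)) * s j)"] by simp
  qed
  finally show ?thesis
    by (simp add: cos_sym_def)
qed

lemma cos_sym_times_cos_sym:
  "cos_sym n m s * cos_sym n m' s = inverse (real (card (perms n))) *
     (\<Sum>v\<in>perms n. \<Sum>w\<in>perms n.
        \<Prod>j=1..n. cos (pi * of_int (m (v j)) * s j) * cos (pi * of_int (m' (w j)) * s j))"
proof -
  have "real (card (perms n)) powr (- 1 / 2) * real (card (perms n)) powr (- 1 / 2)
      = inverse (real (card (perms n)))"
    using card_perms_pos[of n] by (simp only: powr_add[symmetric]) (simp add: powr_minus)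
  moreover have "cos_sym n m s * cos_sym n m' s =
      (real (card (perms n)) powr (- 1 / 2) * real (card (perms n)) powr (- 1 / 2)) *
     (\<Sum>v\<in>perms n. \<Sum>w\<in>perms n.
        \<Prod>j=1..n. cos (pi * of_int (m (v j)) * s j) * cos (pi * of_int (m' (w j)) * s j))"
    by (simp only: cos_sym_def prod.distrib sum_product[symmetric] mult_ac)
  ultimately show ?thesis by simp
qed

text \<open>Weight and summand both factor over coordinates, so the sum over the product set is a
  product of one-dimensional sums, and one differing coordinate makes it vanish. No ordering is
  assumed, so that the result applies to permuted tuples.\<close>

lemma sum_grid_tuples_prod_cos:
  assumes N: "N \<ge> 1" and m: "m \<in> {1..n} \<rightarrow>\<^sub>E {0..int N}" and m': "m' \<in> {1..n} \<rightarrow>\<^sub>E {0..int N}"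
  shows "(\<Sum>s\<in>grid_tuples n N. c_tuple n s *
            (\<Prod>j=1..n. cos (pi * of_int (m j) * s j) * cos (pi * of_int (m' j) * s j)))
           = (if m = m' then real N ^ n * r_tuple n N m else 0)"
proof -
  let ?h = "\<lambda>j s. c_weight s * (cos (pi * of_int (m j) * s) * cos (pi * of_int (m' j) * s))"
  have "(\<Sum>s\<in>grid_tuples n N. c_tuple n s *
          (\<Prod>j=1..n. cos (pi * of_int (m j) * s j) * cos (pi * of_int (m' j) * s j)))
      = (\<Sum>s\<in>{1..n} \<rightarrow>\<^sub>E grid N. \<Prod>j=1..n. ?h j (s j))"
    by (simp only: grid_tuples_def c_tuple_def prod.distrib)
  also have "\<dots> = (\<Prod>j=1..n. \<Sum>s\<in>grid N. ?h j s)"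
    by (rule prod_sum_PiE[symmetric]) (simp_all add: finite_grid)
  also have "\<dots> = (\<Prod>j=1..n. if m j = m' j then real N * r_weight N (m j) else 0)"
    using m m' by (intro prod.cong refl sum_grid_cos_cos[OF N]) (auto dest: PiE_mem)
  also have "\<dots> = (if m = m' then real N ^ n * r_tuple n N m else 0)"
  proof (cases "m = m'")
    case True
    then show ?thesis by (simp add: r_tuple_def prod.distrib)
  next
    case False
    then obtain j where "j \<in> {1..n}" "m j \<noteq> m' j"
      using m m' by (meson PiE_ext)
    then show ?thesis using False by (auto intro!: prod_zero)
  qed
  finally show ?thesis .
qed

lemma sum_grid_tuples_cos_sym:
  assumes N: "N \<ge> 1" and m: "m \<in> ordered_int_tuples n N" and m': "m' \<in> ordered_int_tuples n N"
  shows "(\<Sum>s\<in>grid_tuples n N. c_tuple n s * cos_sym n m s * cos_sym n m' s)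
           = real N ^ n * r_tuple n N m * real (card (tuple_stabilizer n m))
             * (if m = m' then 1 else 0)"
proof -
  let ?P = "perms n" and ?K = "real N ^ n * r_tuple n N m"
  have tup: "m \<in> {1..n} \<rightarrow>\<^sub>E {0..int N}" "m' \<in> {1..n} \<rightarrow>\<^sub>E {0..int N}"
    and mono: "antimono_on {1..n} m" "antimono_on {1..n} m'"
    using m m' by (simp_all add: ordered_int_tuples_def)
  have "(\<Sum>s\<in>grid_tuples n N. c_tuple n s * cos_sym n m s * cos_sym n m' s)
      = (\<Sum>s\<in>grid_tuples n N. inverse (real (card ?P)) * (\<Sum>v\<in>?P. \<Sum>w\<in>?P. c_tuple n s *
          (\<Prod>j=1..n. cos (pi * of_int ((m \<circ> v) j) * s j) * cos (pi * of_int ((m' \<circ> w) j) * s j))))"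
    by (simp only: cos_sym_times_cos_sym mult.assoc sum_distrib_left comp_apply mult.left_commute)
  also have "\<dots> = inverse (real (card ?P)) *
      (\<Sum>v\<in>?P. \<Sum>w\<in>?P. \<Sum>s\<in>grid_tuples n N. c_tuple n s *
          (\<Prod>j=1..n. cos (pi * of_int ((m \<circ> v) j) * s j) * cos (pi * of_int ((m' \<circ> w) j) * s j)))"
    by (simp only: sum_distrib_left[symmetric] sum.swap[of _ "grid_tuples n N" ?P])
  also have "\<dots> = inverse (real (card ?P)) *
      (\<Sum>v\<in>?P. \<Sum>w\<in>?P. if m \<circ> v = m' \<circ> w then ?K else 0)"
    by (intro arg_cong2[where f = "(*)"] sum.cong refl)
      (simp only: sum_grid_tuples_prod_cos[OF N PiE_comp_perms[OF tup(1)] PiE_comp_perms[OF tup(2)]]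
        r_tuple_comp_perms)
  also have "\<dots> = ?K * real (card (tuple_stabilizer n m)) * (if m = m' then 1 else 0)"
  proof (cases "m = m'")
    \<comment> \<open>Every \<open>v\<close> admits equally many \<open>w\<close>, namely the order
      of the stabilizer; the sum over \<open>v\<close> then cancels the normalising factor.\<close>
    case True
    have "(\<Sum>w\<in>?P. if m \<circ> v = m \<circ> w then ?K else 0) = real (card (tuple_stabilizer n m)) * ?K"
      if "v \<in> ?P" for v
      using card_same_image_eq_card_stabilizer[OF tup(1) that]
      by (simp add: sum.If_cases[OF finite_perms] Int_def eq_commute[of "m \<circ> v"])
    then show ?thesis
      using True card_perms_pos[of n] by simp
  next
    case False
    then have "m \<circ> v \<noteq> m' \<circ> w" if "v \<in> ?P" "w \<in> ?P" for v w
      using antimono_rearrangement_unique[OF tup(1) mono(1) tup(2) mono(2) that] by blast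
    then show ?thesis using False by simp
  qed
  finally show ?thesis .
qed

theorem proposition2:
  fixes n N :: nat and m m' :: "nat \<Rightarrow> int"
  assumes "n \<ge> 1" and "N \<ge> 1"
    and "m \<in> ordered_int_tuples n N" and "m' \<in> ordered_int_tuples n N"
  shows "(\<Sum>s\<in>grid_tuples n N. c_tuple n s * cos_sym n m s * cos_sym n m' s)
           = real (card (perms n)) *
             (\<Sum>s\<in>ordered_grid_tuples n N.
                inverse (real (card (tuple_stabilizer n s))) *
                c_tuple n s * cos_sym n m s * cos_sym n m' s)
       \<and> real (card (perms n)) *
             (\<Sum>s\<in>ordered_grid_tuples n N.
                inverse (real (card (tuple_stabilizer n s))) *
                c_tuple n s * cos_sym n m s * cos_sym n m' s)
           = real N ^ n * r_tuple n N m * real (card (tuple_stabilizer n m))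
             * (if m = m' then 1 else 0)"
proof -
  have "(\<Sum>s\<in>grid_tuples n N. c_tuple n s * cos_sym n m s * cos_sym n m' s)
      = real (card (perms n)) *
        (\<Sum>s\<in>ordered_grid_tuples n N.
           inverse (real (card (tuple_stabilizer n s))) *
           (c_tuple n s * cos_sym n m s * cos_sym n m' s))"
    unfolding ordered_grid_tuples_def grid_tuples_def
    by (rule sum_tuples_eq_sum_antimono_tuples[OF finite_grid])
       (simp add: c_tuple_comp_perms cos_sym_comp_perms)
  \<comment> \<open>The second equality comes from evaluating the unrestricted sum; the sum over
    decreasing tuples is never computed directly.\<close>
  then show ?thesis
    using sum_grid_tuples_cos_sym[OF assms(2-4)] by (simp add: mult.assoc)
qed

end
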